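(* In the worst violated constraint model, there is an algorithm which, given oracle access to a hidden 1SAT instance $\Phi$ on $n$ variables and $m$ clauses (possibly with repeated clauses), determines whether $\Phi$ is satisfiable in time $O(mn^2)$.
   Context: A 1SAT instance on Boolean variables $x_1,\dots,x_n$ is a conjunction of clauses $C_1,\dots,C_m$, each consisting of a single literal ($x_i$ or $\overline{x}_i$). The same literal may occur as several different clauses. Worst violated constraint model: the formula is hidden and is accessed only through an oracle. A query is a probabilistic assignment $\mathbf{a}:[n]\to[0,1]$, meaning that $\Pr[x_i=1]=\mathbf{a}(i)$ and $\Pr[\overline{x}_i=1]=1-\mathbf{a}(i)$. The violation probability of a clause is the probability that its literal is $0$. If all clauses have violation probability $0$, the oracle reports that the formula is satisfied; otherwise it returns the index $j\in[m]$ of a clause with the highest violation probability, breaking ties arbitrarily (possibly adversarially). Running time is total running time, with each oracle query costing unit time. *)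

theory Defs
  imports Complex_Main "HOL-Library.FuncSet"
begin

section \<open>Hidden 1SAT instances\<close>

text \<open>Variables and clauses are numbered from 0. A clause is a single literal; an instance is a
  list, so that the same literal may occur as several clauses with different indices.\<close>

datatype literal = Pos nat | Neg nat

fun var_of :: "literal \<Rightarrow> nat" where
  "var_of (Pos i) = i"
| "var_of (Neg i) = i"

fun lit_true :: "(nat \<Rightarrow> bool) \<Rightarrow> literal \<Rightarrow> bool" where
  "lit_true x (Pos i) \<longleftrightarrow> x i"
| "lit_true x (Neg i) \<longleftrightarrow> \<not> x i"

definition one_sat_instance :: "nat \<Rightarrow> nat \<Rightarrow> literal list \<Rightarrow> bool" where
  "one_sat_instance n m \<Phi> \<longleftrightarrow> length \<Phi> = m \<and> (\<forall>l \<in> set \<Phi>. var_of l < n)"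

definition satisfiable :: "literal list \<Rightarrow> bool" where
  "satisfiable \<Phi> \<longleftrightarrow> (\<exists>x. \<forall>l \<in> set \<Phi>. lit_true x l)"


section \<open>The worst violated constraint model\<close>

type_synonym prob_assignment = "nat \<Rightarrow> real"

definition prob_assignments :: "nat \<Rightarrow> prob_assignment set" where
  "prob_assignments n = {..<n} \<rightarrow>\<^sub>E {0..1}"

text \<open>The probability that a literal is 1.\<close>

fun lit_prob :: "prob_assignment \<Rightarrow> literal \<Rightarrow> real" where
  "lit_prob a (Pos i) = a i"
| "lit_prob a (Neg i) = 1 - a i"

definition violation :: "prob_assignment \<Rightarrow> literal \<Rightarrow> real" where
  "violation a l = 1 - lit_prob a l"

datatype answer = Satisfied | Violated nat

fun correct_answer :: "literal list \<Rightarrow> prob_assignment \<Rightarrow> answer \<Rightarrow> bool" where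
  "correct_answer \<Phi> a Satisfied \<longleftrightarrow> (\<forall>l \<in> set \<Phi>. violation a l = 0)"
| "correct_answer \<Phi> a (Violated j) \<longleftrightarrow>
     (\<exists>l \<in> set \<Phi>. violation a l \<noteq> 0) \<and> j < length \<Phi> \<and>
     (\<forall>l \<in> set \<Phi>. violation a l \<le> violation a (\<Phi> ! j))"

text \<open>The answerer may break ties adaptively: its answer may depend on all previous queries and
  answers (most recent first), and need not be the same when a query is repeated.\<close>

type_synonym history = "(prob_assignment \<times> answer) list"
type_synonym answerer = "history \<Rightarrow> prob_assignment \<Rightarrow> answer"

definition worst_violated_answerer :: "nat \<Rightarrow> literal list \<Rightarrow> answerer \<Rightarrow> bool" where
  "worst_violated_answerer n \<Phi> orc \<longleftrightarrow>
     (\<forall>h. \<forall>a \<in> prob_assignments n. correct_answer \<Phi> a (orc h a))"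


section \<open>Algorithms and their running time\<close>

text \<open>The machine is a random access machine with unit cost steps, programmed in a while
  language. Memory cells hold natural numbers; the arguments of type nat below are fixed cell
  addresses, and Load and Store provide indirect addressing. The only arithmetic operations are
  addition and truncated subtraction, since unit cost multiplication would be too
  powerful on unbounded numbers.\<close>

datatype com =
    Skip
  | SetConst nat nat
  | Add nat nat nat
  | Sub nat nat nat
  | Load nat nat
  | Store nat nat
  | Query nat nat nat
  | Seq com com
  | IfLess nat nat com com
  | WhileLess nat nat com

type_synonym memory = "nat \<Rightarrow> nat"

text \<open>The query written in memory: numerators of the n probabilities in consecutive cells starting
  at address b, with common denominator d. This represents every rational assignment.\<close>

definition query_of :: "nat \<Rightarrow> memory \<Rightarrow> nat \<Rightarrow> nat \<Rightarrow> prob_assignment" where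
  "query_of n s b d = (\<lambda>i \<in> {..<n}. real (s (b + i)) / real d)"

fun answer_code :: "answer \<Rightarrow> nat" where
  "answer_code Satisfied = 0"
| "answer_code (Violated j) = Suc j"

text \<open>A configuration consists of the stack of commands still to be executed, the memory, and the
  history of the queries. Each application of the step function costs one time unit. The instance
  is accessible only through the answers to the queries. A malformed query makes the machine hang,
  so that it never halts.\<close>

type_synonym config = "com list \<times> memory \<times> history"

fun step :: "nat \<Rightarrow> answerer \<Rightarrow> config \<Rightarrow> config" where
  "step n orc ([], s, h) = ([], s, h)"
| "step n orc (Skip # K, s, h) = (K, s, h)"
| "step n orc (SetConst r k # K, s, h) = (K, s(r := k), h)"
| "step n orc (Add r p q # K, s, h) = (K, s(r := s p + s q), h)"
| "step n orc (Sub r p q # K, s, h) = (K, s(r := s p - s q), h)"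
| "step n orc (Load r p # K, s, h) = (K, s(r := s (s p)), h)"
| "step n orc (Store p r # K, s, h) = (K, s(s p := s r), h)"
| "step n orc (Query r b d # K, s, h) =
     (let a = query_of n s (s b) (s d) in
      if 0 < s d \<and> a \<in> prob_assignments n
      then (K, s(r := answer_code (orc h a)), (a, orc h a) # h)
      else (Query r b d # K, s, h))"
| "step n orc (Seq c1 c2 # K, s, h) = (c1 # c2 # K, s, h)"
| "step n orc (IfLess p q c1 c2 # K, s, h) = ((if s p < s q then c1 else c2) # K, s, h)"
| "step n orc (WhileLess p q c # K, s, h) =
     (if s p < s q then c # WhileLess p q c # K else K, s, h)"

text \<open>Initially cell 0 holds n, cell 1 holds m, and all other cells are zero. On halting, cell 0
  holds the output: 1 for yes and 0 for no.\<close>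

definition init_config :: "com \<Rightarrow> nat \<Rightarrow> nat \<Rightarrow> config" where
  "init_config P n m = ([P], (\<lambda>_. 0)(0 := n, 1 := m), [])"

definition halts_with :: "com \<Rightarrow> nat \<Rightarrow> nat \<Rightarrow> answerer \<Rightarrow> nat \<Rightarrow> bool \<Rightarrow> bool" where
  "halts_with P n m orc t b \<longleftrightarrow>
     (\<exists>s h. (step n orc ^^ t) (init_config P n m) = ([], s, h) \<and> s 0 = (if b then 1 else 0))"

end

theory Submission
  imports Defs
begin

text \<open>Let \<open>U\<close> be the set of variables that occur negated. If \<open>\<Phi>\<close> is satisfiable, then setting exactly
  the variables of \<open>U\<close> to 0 satisfies it. The algorithm keeps for every clause index \<open>j\<close> a number
  \<open>g j\<close> such that, if \<open>\<Phi>\<close> is satisfiable, clause \<open>j\<close> is either a negated variable with number at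
  least \<open>g j\<close>, or \<open>g j = 0\<close>. A round builds a tentative set \<open>D\<close> by adding variables in decreasing order.
  The test query sets \<open>D\<close> to 0 and all other variables to 1. If it is not satisfied, then the rank
  query sets \<open>D\<close> to 1/2 and the others to increasing values above 1/2, so that the answer \<open>j\<close> is
  the negated maximum of \<open>U - D\<close>. Let \<open>t\<close> be the variable added last, from the answer \<open>l\<close>. If
  \<open>g j < t\<close>, then \<open>g j\<close> is added to \<open>D\<close>. If \<open>g j > t\<close>, then \<open>g l = t\<close> can be raised to \<open>g j\<close>, because
  the successive maxima decrease. If \<open>g j = t\<close>, then \<open>g j\<close> can be incremented, because \<open>t \<in> D\<close>. In the
  last two cases a new round starts. Hence there are at most \<open>m n\<close> rounds of \<open>O(n)\<close> steps, and a bound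
  reaching \<open>n\<close> refutes satisfiability.\<close>

section \<open>The search state\<close>

definition neg_vars :: "literal list \<Rightarrow> nat set" where
  "neg_vars \<Phi> = {v. Neg v \<in> set \<Phi>}"

text \<open>The value 0 on positive literals lets the single inequality
  \<open>g j \<le> neg_var (\<Phi> ! j)\<close> say that only negated clauses carry a nonzero
  bound.\<close>

fun neg_var :: "literal \<Rightarrow> nat" where
  "neg_var (Pos i) = 0"
| "neg_var (Neg i) = i"

definition test_query :: "nat \<Rightarrow> nat set \<Rightarrow> prob_assignment" where
  "test_query n D = (\<lambda>i \<in> {..<n}. if i \<in> D then 0 else 1)"

text \<open>The numerator \<open>n + 1\<close> is exactly 1/2; outside \<open>D\<close> the
  numerators run from \<open>n + 2\<close> to at most \<open>2 * n + 1\<close>. So positive literals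
  are violated with probability at most 1/2, negated ones outside \<open>D\<close> with more,
  increasing in the index, and no violation is 0.\<close>

definition rank_query :: "nat \<Rightarrow> nat set \<Rightarrow> prob_assignment" where
  "rank_query n D = (\<lambda>i \<in> {..<n}. real (if i \<in> D then n + 1 else n + 2 + i) / real (2 * n + 2))"

lemma test_query_prob: "test_query n D \<in> prob_assignments n"
  by (auto simp: test_query_def prob_assignments_def)

lemma rank_query_prob: "rank_query n D \<in> prob_assignments n"
  by (auto simp: rank_query_def prob_assignments_def)

text \<open>The case \<open>t = n\<close> encodes the start of a round, where \<open>D\<close> is empty and \<open>l\<close> is meaningless.\<close>

definition search_shape :: "nat \<Rightarrow> nat \<Rightarrow> nat set \<Rightarrow> nat \<Rightarrow> nat \<Rightarrow> (nat \<Rightarrow> nat) \<Rightarrow> bool" where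
  "search_shape n m D t l g \<longleftrightarrow>
     (\<forall>j<m. g j < n) \<and> D \<subseteq> {t..<n} \<and> t \<le> n \<and> (t < n \<longrightarrow> t \<in> D \<and> l < m \<and> g l = t)"

text \<open>The last conjunct ensures that \<open>U \<subseteq> D\<close> implies \<open>D = U\<close>: an element \<open>u > t\<close> of \<open>U - D\<close> can never
  enter \<open>D\<close> later in the round. Hence an unsatisfied test query shows that \<open>U - D\<close> is nonempty.\<close>

definition search_sound :: "literal list \<Rightarrow> nat set \<Rightarrow> nat \<Rightarrow> nat \<Rightarrow> nat \<Rightarrow> (nat \<Rightarrow> nat) \<Rightarrow> bool" where
  "search_sound \<Phi> D n t l g \<longleftrightarrow>
     (\<forall>j<length \<Phi>. g j \<le> neg_var (\<Phi> ! j)) \<and>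
     (t < n \<longrightarrow> (\<forall>v \<in> neg_vars \<Phi> - D. v \<le> neg_var (\<Phi> ! l))) \<and>
     (D \<subseteq> neg_vars \<Phi> \<or> (\<exists>u \<in> neg_vars \<Phi> - D. t < u))"

section \<open>What the answers to the two queries reveal\<close>

lemma satisfied_imp_satisfiable:
  assumes "correct_answer \<Phi> a Satisfied"
  shows "satisfiable \<Phi>"
proof -
  \<comment> \<open>Violation 0 forces probability 1 on the variable of a positive literal and 0 on
    that of a negated one, so rounding everything below 1 to false is safe.\<close>
  have "lit_true (\<lambda>i. a i = 1) l" if "l \<in> set \<Phi>" for l
    using assms that by (cases l) (force simp: violation_def)+
  then show ?thesis unfolding satisfiable_def by blast
qed

lemma satisfiable_no_clash: "satisfiable \<Phi> \<Longrightarrow> Neg i \<in> set \<Phi> \<Longrightarrow> Pos i \<notin> set \<Phi>"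
  unfolding satisfiable_def by (metis lit_true.simps)

text \<open>If \<open>D\<close> covered all negated variables, the last conjunct of soundness would
  make it equal to their set, and the test query would be the 0/1 assignment that satisfies
  \<open>\<Phi>\<close>.\<close>

lemma test_query_violated:
  assumes inst: "one_sat_instance n m \<Phi>" and sat: "satisfiable \<Phi>"
    and sound: "search_sound \<Phi> D n t l g"
    and ans: "correct_answer \<Phi> (test_query n D) (Violated j)"
  shows "\<not> neg_vars \<Phi> \<subseteq> D"
proof
  assume sub: "neg_vars \<Phi> \<subseteq> D"
  with sound have eq: "D = neg_vars \<Phi>"
    unfolding search_sound_def by auto
  have "violation (test_query n D) c = 0" if c: "c \<in> set \<Phi>" for c
  proof (cases c)
    case (Pos i)
    then have "i < n" using inst c by (auto simp: one_sat_instance_def)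
    moreover have "i \<notin> D"
      using satisfiable_no_clash[OF sat] c Pos by (auto simp: eq neg_vars_def)
    ultimately show ?thesis using Pos by (simp add: violation_def test_query_def)
  next
    case (Neg i)
    then have "i < n" "i \<in> D" using inst c by (auto simp: one_sat_instance_def eq neg_vars_def)
    then show ?thesis using Neg by (simp add: violation_def test_query_def)
  qed
  then show False using ans by auto
qed

lemma rank_query_answer:
  assumes inst: "one_sat_instance n m \<Phi>"
    and ans: "correct_answer \<Phi> (rank_query n D) (Violated j)"
    and ex: "\<not> neg_vars \<Phi> \<subseteq> D"
  obtains v where "\<Phi> ! j = Neg v" "v \<in> neg_vars \<Phi> - D" "\<forall>u \<in> neg_vars \<Phi> - D. u \<le> v"
proof -
  let ?viol = "violation (rank_query n D)"
  have j: "\<Phi> ! j \<in> set \<Phi>" using ans by auto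
  have rank: "?viol (Neg u) = real (n + 2 + u) / real (2 * n + 2)" and ltn: "u < n"
    if "u \<in> neg_vars \<Phi> - D" for u
  proof -
    show "u < n" using that inst by (force simp: one_sat_instance_def neg_vars_def)
    then show "?viol (Neg u) = real (n + 2 + u) / real (2 * n + 2)"
      using that by (simp add: violation_def rank_query_def)
  qed
  have max: "?viol (Neg u) \<le> ?viol (\<Phi> ! j)" if "u \<in> neg_vars \<Phi> - D" for u
    using ans that by (auto simp: neg_vars_def)
  obtain u0 where u0: "u0 \<in> neg_vars \<Phi> - D" using ex by blast
  \<comment> \<open>One negated variable outside \<open>D\<close> lifts the maximum above 1/2, which
    neither positive literals nor negated variables of \<open>D\<close> can reach.\<close>
  have "?viol (Neg u0) > 1 / 2" unfolding rank[OF u0] by (simp add: field_simps)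
  then have gt: "?viol (\<Phi> ! j) > 1 / 2" using max[OF u0] by linarith
  obtain v where v: "\<Phi> ! j = Neg v"
  proof (cases "\<Phi> ! j")
    case (Pos i)
    then have "i < n" using inst j by (force simp: one_sat_instance_def)
    then have False using gt Pos
      by (auto simp: violation_def rank_query_def field_simps split: if_splits)
    then show ?thesis ..
  qed
  have "v < n" using inst j v by (force simp: one_sat_instance_def)
  then have "v \<notin> D" using gt v
    by (auto simp: violation_def rank_query_def field_simps)
  then have mem: "v \<in> neg_vars \<Phi> - D" using j v by (simp add: neg_vars_def)
  have "\<forall>u \<in> neg_vars \<Phi> - D. u \<le> v"
  proof
    fix u assume u: "u \<in> neg_vars \<Phi> - D"
    have "real (n + 2 + u) / real (2 * n + 2) \<le> real (n + 2 + v) / real (2 * n + 2)"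
      using max[OF u] rank[OF u] rank[OF mem] v by simp
    then show "u \<le> v" by (simp add: divide_le_cancel)
  qed
  with v mem show ?thesis using that by blast
qed

text \<open>\<open>refine\<close> uses the answer to the rank query as a table offset without
  testing for \<open>Satisfied\<close>. This is safe because every violation is positive.\<close>

lemma rank_query_violated:
  assumes "one_sat_instance n m \<Phi>" "\<Phi> \<noteq> []"
  shows "\<not> correct_answer \<Phi> (rank_query n D) Satisfied"
proof -
  have "violation (rank_query n D) l \<noteq> 0" if "l \<in> set \<Phi>" for l
    using assms(1) that
    by (cases l) (auto simp: one_sat_instance_def violation_def rank_query_def field_simps
        dest!: bspec[of _ _ l])
  then show ?thesis using assms(2) by (cases \<Phi>) auto
qed

section \<open>Effect of one pair of answers on the search state\<close>

context
  fixes n m \<Phi> D t l g j i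
  assumes inst: "one_sat_instance n m \<Phi>"
    and shape: "search_shape n m D t l g"
    and sound: "satisfiable \<Phi> \<longrightarrow> search_sound \<Phi> D n t l g"
    and test: "correct_answer \<Phi> (test_query n D) (Violated i)"
    and rank: "correct_answer \<Phi> (rank_query n D) (Violated j)"
begin

lemma answer_index: "j < m"
  using rank inst by (simp add: one_sat_instance_def)

lemma answer_var:
  assumes sat: "satisfiable \<Phi>"
  obtains v where "neg_var (\<Phi> ! j) = v" "v \<in> neg_vars \<Phi> - D" "\<forall>u \<in> neg_vars \<Phi> - D. u \<le> v"
    "g j \<le> v" "v < n"
proof -
  have snd: "search_sound \<Phi> D n t l g" using sound sat by blast
  obtain v where v: "\<Phi> ! j = Neg v" "v \<in> neg_vars \<Phi> - D" "\<forall>u \<in> neg_vars \<Phi> - D. u \<le> v"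
    using rank_query_answer[OF inst rank test_query_violated[OF inst sat snd test]] by blast
  have "v < n" using inst v(2) by (force simp: one_sat_instance_def neg_vars_def)
  moreover have "g j \<le> v" using snd rank v(1) by (auto simp: search_sound_def)
  ultimately show ?thesis using that v by simp
qed

text \<open>Only soundness is conditional: the shape must survive on unsatisfiable instances as
  well, since the running time is bounded there too.\<close>

lemma search_extend:
  assumes "g j < t"
  shows "search_shape n m (insert (g j) D) (g j) j g"
    and "satisfiable \<Phi> \<longrightarrow> search_sound \<Phi> (insert (g j) D) n (g j) j g"
proof -
  show "search_shape n m (insert (g j) D) (g j) j g"
    using shape assms answer_index by (force simp: search_shape_def)
  show "satisfiable \<Phi> \<longrightarrow> search_sound \<Phi> (insert (g j) D) n (g j) j g"
  proof
    assume sat: "satisfiable \<Phi>"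
    then obtain v where v: "neg_var (\<Phi> ! j) = v" "v \<in> neg_vars \<Phi> - D"
      "\<forall>u \<in> neg_vars \<Phi> - D. u \<le> v" "g j \<le> v" using answer_var by blast
    have "insert (g j) D \<subseteq> neg_vars \<Phi> \<or> (\<exists>u \<in> neg_vars \<Phi> - insert (g j) D. g j < u)"
    proof (cases "D \<subseteq> neg_vars \<Phi>")
      case True
      show ?thesis
      proof (cases "g j = v")
        case True
        then show ?thesis using v \<open>D \<subseteq> neg_vars \<Phi>\<close> by auto
      next
        case False
        \<comment> \<open>Here \<open>g j < v\<close>: the added variable may be wrong, but then
          \<open>v\<close> stays outside as a witness above the new threshold.\<close>
        then show ?thesis using v by (intro disjI2 bexI[of _ v]) auto
      qed
    next
      case False
      then obtain u where "u \<in> neg_vars \<Phi> - D" "t < u"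
        using sound sat by (auto simp: search_sound_def)
      \<comment> \<open>An earlier witness survives, because \<open>g j < t < u\<close>.\<close>
      then show ?thesis using assms by (intro disjI2 bexI[of _ u]) auto
    qed
    then show "search_sound \<Phi> (insert (g j) D) n (g j) j g"
      using sound sat v by (auto simp: search_sound_def)
  qed
qed

text \<open>In the satisfiable case the invariant keeps \<open>neg_var (\<Phi> ! l)\<close> above
  all of \<open>neg_vars \<Phi> - D\<close>, which contains the variable \<open>v\<close> of clause
  \<open>j\<close>; hence \<open>g j \<le> v \<le> neg_var (\<Phi> ! l)\<close>.\<close>

lemma search_raise:
  assumes "t < g j"
  shows "l < m" "g l = t" "search_shape n m {} n l' (g(l := g j))"
    and "satisfiable \<Phi> \<longrightarrow> search_sound \<Phi> {} n n l' (g(l := g j))"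
proof -
  have t: "t < n" "l < m" "g l = t"
    using shape assms answer_index by (force simp: search_shape_def)+
  then show "l < m" "g l = t" by auto
  show "search_shape n m {} n l' (g(l := g j))"
    using shape answer_index by (auto simp: search_shape_def)
  show "satisfiable \<Phi> \<longrightarrow> search_sound \<Phi> {} n n l' (g(l := g j))"
  proof
    assume sat: "satisfiable \<Phi>"
    then obtain v where "v \<in> neg_vars \<Phi> - D" "g j \<le> v" using answer_var by blast
    moreover have "\<forall>v \<in> neg_vars \<Phi> - D. v \<le> neg_var (\<Phi> ! l)"
      using sound sat t by (simp add: search_sound_def)
    ultimately have "g j \<le> neg_var (\<Phi> ! l)"
      using le_trans by blast
    then show "search_sound \<Phi> {} n n l' (g(l := g j))"
      using sound sat by (simp add: search_sound_def)
  qed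
qed

text \<open>In the satisfiable case the variable of clause \<open>j\<close> lies outside
  \<open>D\<close> while \<open>t\<close> lies in \<open>D\<close>, so the bound
  \<open>g j = t\<close> is not tight. As that variable is below \<open>n\<close>, a bound about to
  reach \<open>n\<close> is a refutation.\<close>

lemma search_increment:
  assumes "g j = t"
  shows "satisfiable \<Phi> \<longrightarrow> Suc t < n"
    and "Suc t < n \<Longrightarrow> search_shape n m {} n l' (g(j := Suc t))"
    and "satisfiable \<Phi> \<longrightarrow> search_sound \<Phi> {} n n l' (g(j := Suc t))"
proof -
  have "t < n" using shape assms answer_index by (auto simp: search_shape_def)
  then have t: "t \<in> D" using shape by (auto simp: search_shape_def)
  have *: "Suc t \<le> neg_var (\<Phi> ! j)" "Suc t < n" if sat: "satisfiable \<Phi>"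
  proof -
    obtain v where v: "neg_var (\<Phi> ! j) = v" "v \<in> neg_vars \<Phi> - D" "g j \<le> v" "v < n"
      using sat answer_var by blast
    then have "t \<noteq> v" using t by auto
    then show "Suc t \<le> neg_var (\<Phi> ! j)" "Suc t < n" using v assms by auto
  qed
  show "satisfiable \<Phi> \<longrightarrow> Suc t < n" using * by blast
  show "Suc t < n \<Longrightarrow> search_shape n m {} n l' (g(j := Suc t))"
    using shape by (auto simp: search_shape_def)
  show "satisfiable \<Phi> \<longrightarrow> search_sound \<Phi> {} n n l' (g(j := Suc t))"
    using * sound by (simp add: search_sound_def)
qed

end

text \<open>The weight \<open>2 n + 2\<close> lets one unit of progress of the bounds pay for resetting \<open>t\<close> to \<open>n\<close> and
  for the linear cost of rewriting both queries.\<close>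

definition potential :: "nat \<Rightarrow> nat \<Rightarrow> nat \<Rightarrow> (nat \<Rightarrow> nat) \<Rightarrow> nat" where
  "potential n m t g = (\<Sum>j<m. n - g j) * (2 * n + 2) + t"

text \<open>The sum drops by at least one, which releases \<open>2 * n + 2\<close>; resetting the
  threshold to \<open>n\<close> consumes at most \<open>n\<close> of this.\<close>

lemma potential_update:
  assumes "j < m" "g j < k" "g j < n"
  shows "potential n m n (g(j := k)) + n + 2 \<le> potential n m t g"
proof -
  have "(\<Sum>i<m. n - (g(j := k)) i) < (\<Sum>i<m. n - g i)"
    using assms by (intro sum_strict_mono_ex1) auto
  then have "Suc (\<Sum>i<m. n - (g(j := k)) i) * (2 * n + 2) \<le> (\<Sum>i<m. n - g i) * (2 * n + 2)"
    by (intro mult_le_mono1) simp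
  then show ?thesis by (simp add: potential_def)
qed

section \<open>The machine program\<close>

text \<open>An upper bound instead of an exact count lets branches of different length share one
  estimate.\<close>

definition reaches :: "nat \<Rightarrow> answerer \<Rightarrow> nat \<Rightarrow> config \<Rightarrow> config \<Rightarrow> bool" where
  "reaches n orc b x y \<longleftrightarrow> (\<exists>t\<le>b. (step n orc ^^ t) x = y)"

lemma reachesI: "(step n orc ^^ t) x = y \<Longrightarrow> t \<le> b \<Longrightarrow> reaches n orc b x y"
  by (auto simp: reaches_def)

lemma reaches_trans:
  assumes "reaches n orc b x y" "reaches n orc c y z" "b + c \<le> d"
  shows "reaches n orc d x z"
proof -
  obtain t u where "t \<le> b" "u \<le> c" "(step n orc ^^ t) x = y" "(step n orc ^^ u) y = z"
    using assms(1,2) by (auto simp: reaches_def)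
  then show ?thesis using assms(3) by (intro reachesI[where t = "u + t"]) (auto simp: funpow_add)
qed

text \<open>Each listed command costs one extra step for its \<open>Seq\<close>. The closing
  \<open>Skip\<close> is still on the stack while the last command runs, hence the
  \<open>Skip\<close> entries in the configurations below.\<close>

definition block :: "com list \<Rightarrow> com" where
  "block cs = foldr Seq cs Skip"

text \<open>Cells 2 to 8 hold the constants 1, 0, \<open>2 n + 2\<close>, \<open>n + 1\<close> and the base addresses of the test
  query, of the rank query and of the table of lower bounds. Since an answer \<open>Violated j\<close> is coded as
  \<open>Suc j\<close>, the bound of clause \<open>j\<close> is at offset \<open>Suc j\<close>. Cells 9 and 10 hold the threshold and the
  table address of the clause last used to extend the tentative set. The table needs no
  initialization, because fresh memory is zero.\<close>

definition fill_body :: com where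
  "fill_body = block [Store 14 4, Store 15 16, Add 14 14 2, Add 15 15 2, Add 16 16 2]"

definition reset :: com where
  "reset = block [Add 14 6 3, Add 15 7 3, Add 16 5 2, Add 9 0 3, WhileLess 14 7 fill_body]"

definition extend :: com where
  "extend = block [Add 14 6 13, Store 14 3, Add 14 7 13, Store 14 5, Add 9 13 3, Add 10 12 3]"

definition raise_last :: com where
  "raise_last = block [Store 10 13, reset]"

definition increment :: com where
  "increment = block [Add 13 13 2, Store 12 13, IfLess 13 0 reset (SetConst 17 1)]"

definition refine :: com where
  "refine = block [Query 11 7 4, Add 12 8 11, Load 13 12,
     IfLess 13 9 extend (IfLess 9 13 raise_last increment)]"

definition search_body :: com where
  "search_body = block [Query 11 6 4, IfLess 3 11 refine (SetConst 17 1)]"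

definition solver :: com where
  "solver = block [SetConst 2 1, Add 5 0 2, Add 4 5 5, SetConst 6 20, Add 7 6 0, Add 8 7 0, reset,
     WhileLess 17 2 search_body, IfLess 3 11 (SetConst 0 0) (SetConst 0 1)]"

text \<open>Cell 17 is the stop flag, 0 during the search. Cells 11 to 16 are left free: 11 to 13
  receive the answer, its table address and its bound, 14 to 16 are scratch.\<close>

definition registers :: "nat \<Rightarrow> nat \<Rightarrow> (nat \<Rightarrow> nat) \<Rightarrow> memory \<Rightarrow> bool" where
  "registers n m g s \<longleftrightarrow>
     s 0 = n \<and> s 2 = 1 \<and> s 3 = 0 \<and> s 4 = 2 * n + 2 \<and> s 5 = n + 1 \<and> s 6 = 20 \<and> s 7 = 20 + n \<and>
     s 8 = 20 + 2 * n \<and> s 17 = 0 \<and> (\<forall>j<m. s (21 + 2 * n + j) = g j)"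

definition represents ::
  "nat \<Rightarrow> nat \<Rightarrow> nat set \<Rightarrow> nat \<Rightarrow> nat \<Rightarrow> (nat \<Rightarrow> nat) \<Rightarrow> memory \<Rightarrow> bool" where
  "represents n m D t l g s \<longleftrightarrow>
     registers n m g s \<and> s 9 = t \<and> (t < n \<longrightarrow> s 10 = 21 + 2 * n + l) \<and>
     (\<forall>i<n. s (20 + i) = (if i \<in> D then 0 else 2 * n + 2)) \<and>
     (\<forall>i<n. s (20 + n + i) = (if i \<in> D then n + 1 else n + 2 + i))"

text \<open>Peels one step off a literal count, so that simplification executes programs
  symbolically.\<close>

lemma funpow_numeral_apply: "(f ^^ numeral k) x = (f ^^ pred_numeral k) (f x)"
  by (simp add: numeral_eq_Suc funpow_Suc_right del: funpow.simps)

lemmas run_simps = funpow_numeral_apply block_def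

section \<open>Running times and effects of the program pieces\<close>

lemma fill_loop:
  assumes "i \<le> n" "registers n m g s" "s 14 = 20 + i" "s 15 = 20 + n + i" "s 16 = n + 2 + i"
    "s 9 = n"
    "\<forall>k<i. s (20 + k) = 2 * n + 2" "\<forall>k<i. s (20 + n + k) = n + 2 + k"
  shows "\<exists>s'. reaches n orc (12 * (n - i) + 1) (WhileLess 14 7 fill_body # K, s, h) (K, s', h) \<and>
           represents n m {} n l g s'"
  using assms
proof (induction "n - i" arbitrary: i s)
  case 0
  then have "represents n m {} n l g s" by (simp add: represents_def)
  \<comment> \<open>The rank query begins right after the test query, so at \<open>i = n\<close>
    cell 14 equals cell 7 and the guard fails.\<close>
  moreover have "reaches n orc 1 (WhileLess 14 7 fill_body # K, s, h) (K, s, h)"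
    by (rule reachesI[where t = 1]) (use 0 in \<open>auto simp: registers_def\<close>)
  ultimately show ?case using 0 by auto
next
  case (Suc r)
  define s1 where "s1 = s(20 + i := 2 * n + 2, 20 + n + i := n + 2 + i,
    14 := 21 + i, 15 := 21 + n + i, 16 := n + 3 + i)"
  have "reaches n orc 12 (WhileLess 14 7 fill_body # K, s, h) (WhileLess 14 7 fill_body # K, s1, h)"
    by (rule reachesI[where t = 12])
      (use Suc in \<open>auto simp: run_simps fill_body_def registers_def s1_def intro!: ext\<close>)
  moreover have "\<exists>s'. reaches n orc (12 * (n - Suc i) + 1) (WhileLess 14 7 fill_body # K, s1, h)
      (K, s', h) \<and> represents n m {} n l g s'"
    by (rule Suc.hyps) (use Suc in \<open>auto simp: s1_def registers_def less_Suc_eq\<close>)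
  moreover have "12 + (12 * (n - Suc i) + 1) \<le> 12 * (n - i) + 1" using Suc.hyps(2) by linarith
  ultimately show ?case using reaches_trans by blast
qed

lemma reset_run:
  assumes "registers n m g s"
  obtains s' where "reaches n orc (12 * n + 12) (reset # K, s, h) (K, s', h)"
    "represents n m {} n l g s'"
proof -
  define s1 where "s1 = s(14 := 20, 15 := 20 + n, 16 := n + 2, 9 := n)"
  have "reaches n orc 9 (reset # K, s, h)
      (WhileLess 14 7 fill_body # Skip # K, s1, h)"
    by (rule reachesI[where t = 9])
      (use assms in \<open>auto simp: run_simps reset_def registers_def s1_def intro!: ext\<close>)
  moreover obtain s' where s': "reaches n orc (12 * n + 1) (WhileLess 14 7 fill_body # Skip # K, s1, h)
      (Skip # K, s', h)" "represents n m {} n l g s'"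
    using fill_loop[of 0 n m g s1 orc "Skip # K" h l] assms by (auto simp: s1_def registers_def)
  ultimately have "reaches n orc (12 * n + 10) (reset # K, s, h) (Skip # K, s', h)"
    using reaches_trans by fastforce
  moreover have "reaches n orc 1 (Skip # K, s', h) (K, s', h)"
    by (rule reachesI[where t = 1]) auto
  ultimately have "reaches n orc (12 * n + 12) (reset # K, s, h) (K, s', h)"
    by (rule reaches_trans) simp
  with s' show ?thesis using that by blast
qed

lemma query_of_test:
  assumes "represents n m D t l g s"
  shows "query_of n s (s 6) (s 4) = test_query n D"
  using assms by (auto simp: represents_def registers_def query_of_def test_query_def intro!: ext)

lemma query_of_rank:
  assumes "represents n m D t l g s"
  shows "query_of n s (s 7) (s 4) = rank_query n D"
  using assms by (auto simp: represents_def registers_def query_of_def rank_query_def intro!: ext)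

lemma test_run:
  assumes rep: "represents n m D t l g s"
    and ans: "orc h (test_query n D) = a"
  shows "reaches n orc 5 (WhileLess 17 2 search_body # K, s, h)
    ((if a = Satisfied then SetConst 17 1 else refine) # Skip # WhileLess 17 2 search_body # K,
     s(11 := answer_code a), (test_query n D, a) # h)"
proof -
  have regs: "s 3 = 0" "s 2 = 1" "s 17 = 0" "s 4 > 0"
    using rep by (auto simp: represents_def registers_def)
  show ?thesis
    by (rule reachesI[where t = 5, OF _ order_refl])
      (use regs ans query_of_test[OF rep] test_query_prob[of n D]
        in \<open>cases a; auto simp: run_simps search_body_def Let_def\<close>)
qed

lemma represents_upd: "represents n m D t l g s \<Longrightarrow> r \<in> {11, 12, 13} \<Longrightarrow>
  represents n m D t l g (s(r := x))"
  by (elim insertE) (simp_all add: represents_def registers_def)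

lemma rank_run:
  assumes rep: "represents n m D t l g s"
    and ans: "orc h (rank_query n D) = Violated j" and j: "j < m"
  shows "reaches n orc 8 (refine # K, s, h)
    ((if g j < t then extend else IfLess 9 13 raise_last increment) # Skip # K,
     s(11 := Suc j, 12 := 21 + 2 * n + j, 13 := g j), (rank_query n D, Violated j) # h)"
proof -
  have regs: "s 3 = 0" "s 9 = t" "s 8 = 20 + 2 * n" "s (21 + (2 * n + j)) = g j" "s 4 > 0"
    using rep j by (auto simp: represents_def registers_def add.assoc)
  show ?thesis
    by (rule reachesI[where t = 8])
      (use regs ans query_of_rank[OF rep] rank_query_prob[of n D]
        in \<open>auto simp: run_simps refine_def Let_def intro!: ext\<close>)
qed

lemma extend_run:
  assumes rep: "represents n m D t l g s" and "s 12 = 21 + 2 * n + j" "s 13 = k" "k < n"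
  obtains s' where "reaches n orc 13 (extend # K, s, h) (K, s', h)"
    "represents n m (insert k D) k j g s'"
proof -
  define s' where "s' = s(20 + k := 0, 14 := 20 + n + k, 20 + n + k := n + 1, 9 := k,
    10 := 21 + 2 * n + j)"
  have "reaches n orc 13 (extend # K, s, h) (K, s', h)"
    by (rule reachesI[where t = 13])
      (use assms in \<open>auto simp: run_simps extend_def represents_def registers_def s'_def intro!: ext\<close>)
  moreover have "represents n m (insert k D) k j g s'"
    using assms by (auto simp: represents_def registers_def s'_def)
  ultimately show ?thesis using that by blast
qed

lemma raise_run:
  assumes rep: "represents n m D t l g s" and "s 13 = k" "t < n" "l < m"
  obtains s' where "reaches n orc (12 * n + 16) (raise_last # K, s, h) (K, s', h)"
    "represents n m {} n l' (g(l := k)) s'"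
proof -
  define s1 where "s1 = s(21 + 2 * n + l := k)"
  have "reaches n orc 3 (raise_last # K, s, h) (reset # Skip # K, s1, h)"
    by (rule reachesI[where t = 3])
      (use assms in \<open>auto simp: run_simps raise_last_def represents_def registers_def s1_def intro!: ext\<close>)
  moreover have "registers n m (g(l := k)) s1"
    using assms by (auto simp: represents_def registers_def s1_def)
  then obtain s' where s': "reaches n orc (12 * n + 12) (reset # Skip # K, s1, h) (Skip # K, s', h)"
    "represents n m {} n l' (g(l := k)) s'" using reset_run by blast
  ultimately have "reaches n orc (12 * n + 15) (raise_last # K, s, h) (Skip # K, s', h)"
    using reaches_trans by fastforce
  moreover have "reaches n orc 1 (Skip # K, s', h) (K, s', h)"
    by (rule reachesI[where t = 1]) auto
  ultimately have "reaches n orc (12 * n + 16) (raise_last # K, s, h) (K, s', h)"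
    by (rule reaches_trans) simp
  with s' show ?thesis using that by blast
qed

lemma increment_run:
  assumes rep: "represents n m D t l g s" and "s 12 = 21 + 2 * n + j" "s 13 = t" "j < m"
  shows "Suc t < n \<Longrightarrow> \<exists>s'. reaches n orc (12 * n + 20) (increment # K, s, h) (K, s', h) \<and>
      represents n m {} n l' (g(j := Suc t)) s'"
    and "\<not> Suc t < n \<Longrightarrow> reaches n orc 8 (increment # K, s, h)
      (K, s(13 := Suc t, 21 + 2 * n + j := Suc t, 17 := 1), h)"
proof -
  define s1 where "s1 = s(13 := Suc t, 21 + 2 * n + j := Suc t)"
  assume lt: "Suc t < n"
  have "reaches n orc 6 (increment # K, s, h) (reset # Skip # K, s1, h)"
    by (rule reachesI[where t = 6])
      (use assms lt in \<open>auto simp: run_simps increment_def represents_def registers_def s1_def intro!: ext\<close>)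
  moreover have "registers n m (g(j := Suc t)) s1"
    using assms by (auto simp: represents_def registers_def s1_def)
  then obtain s' where s': "reaches n orc (12 * n + 12) (reset # Skip # K, s1, h) (Skip # K, s', h)"
    "represents n m {} n l' (g(j := Suc t)) s'" using reset_run by blast
  ultimately have "reaches n orc (12 * n + 18) (increment # K, s, h) (Skip # K, s', h)"
    using reaches_trans by fastforce
  moreover have "reaches n orc 1 (Skip # K, s', h) (K, s', h)"
    by (rule reachesI[where t = 1]) auto
  ultimately have "reaches n orc (12 * n + 20) (increment # K, s, h) (K, s', h)"
    by (rule reaches_trans) simp
  with s' show "\<exists>s'. reaches n orc (12 * n + 20) (increment # K, s, h) (K, s', h) \<and>
      represents n m {} n l' (g(j := Suc t)) s'" by blast
next
  assume "\<not> Suc t < n"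
  then show "reaches n orc 8 (increment # K, s, h)
      (K, s(13 := Suc t, 21 + 2 * n + j := Suc t, 17 := 1), h)"
    by (intro reachesI[where t = 8])
      (use assms in \<open>auto simp: run_simps increment_def represents_def registers_def intro!: ext\<close>)
qed

section \<open>The main loop and its amortized cost\<close>

definition search_state ::
  "nat \<Rightarrow> nat \<Rightarrow> literal list \<Rightarrow> nat set \<Rightarrow> nat \<Rightarrow> nat \<Rightarrow> (nat \<Rightarrow> nat) \<Rightarrow> memory \<Rightarrow> bool" where
  "search_state n m \<Phi> D t l g s \<longleftrightarrow> represents n m D t l g s \<and> search_shape n m D t l g \<and>
     (satisfiable \<Phi> \<longrightarrow> search_sound \<Phi> D n t l g)"

lemma two_skips: "reaches n orc 2 (Skip # Skip # K, s, h) (K, s, h)"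
  by (rule reachesI[where t = 2]) (auto simp: run_simps)

text \<open>The factor 40 covers every case: an extension takes 28 steps for a drop of at least 1,
  and a new round takes at most \<open>12 * n + 40\<close> steps for a drop of at least
  \<open>n + 2\<close>.\<close>

lemma search_iteration:
  fixes K
  defines "W \<equiv> WhileLess 17 2 search_body # K"
  assumes inst: "one_sat_instance n m \<Phi>" and orc: "worst_violated_answerer n \<Phi> orc"
    and st: "search_state n m \<Phi> D t l g s"
  shows "(\<exists>s' h'. reaches n orc 40 (W, s, h) (K, s', h') \<and> s' 3 = 0 \<and> (s' 11 = 0 \<longleftrightarrow> satisfiable \<Phi>)) \<or>
    (\<exists>D' t' l' g' s' h' b. reaches n orc b (W, s, h) (W, s', h') \<and> search_state n m \<Phi> D' t' l' g' s' \<and>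
       potential n m t' g' < potential n m t g \<and>
       b + 40 * potential n m t' g' \<le> 40 * potential n m t g)"
proof -
  have rep: "represents n m D t l g s" and shape: "search_shape n m D t l g"
    and sound: "satisfiable \<Phi> \<longrightarrow> search_sound \<Phi> D n t l g"
    using st by (auto simp: search_state_def)
  have s3: "s 3 = 0" and s2: "s 2 = 1" using rep by (auto simp: represents_def registers_def)
  define a where "a = orc h (test_query n D)"
  have a: "correct_answer \<Phi> (test_query n D) a"
    using orc test_query_prob by (simp add: worst_violated_answerer_def a_def)
  note test = test_run[of n m D t l g s orc h a K, OF rep a_def[symmetric], folded W_def]
  define h1 where "h1 = (test_query n D, a) # h"
  show ?thesis
  proof (cases a)
    case Satisfied
    have "reaches n orc 3 (SetConst 17 1 # Skip # W, s(11 := 0), h1) (K, s(11 := 0, 17 := 1), h1)"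
      by (rule reachesI[where t = 3]) (use s2 in \<open>auto simp: run_simps W_def\<close>)
    then have "reaches n orc 40 (W, s, h) (K, s(11 := 0, 17 := 1), h1)"
      using reaches_trans[OF test] Satisfied by (simp add: h1_def)
    moreover have "satisfiable \<Phi>" using a Satisfied satisfied_imp_satisfiable by simp
    then have "(s(11 := 0, 17 := 1)) 3 = 0" "(s(11 := 0, 17 := 1)) 11 = 0 \<longleftrightarrow> satisfiable \<Phi>"
      using s3 by simp_all
    ultimately show ?thesis by (intro disjI1 exI conjI)
  next
    case (Violated i)
    have test_v: "correct_answer \<Phi> (test_query n D) (Violated i)" using a Violated by simp
    then have "\<Phi> \<noteq> []" by auto
    then have "\<not> correct_answer \<Phi> (rank_query n D) Satisfied" by (rule rank_query_violated[OF inst])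
    moreover have rank_ok: "correct_answer \<Phi> (rank_query n D) (orc h1 (rank_query n D))"
      using orc rank_query_prob by (simp add: worst_violated_answerer_def)
    ultimately obtain j where j: "orc h1 (rank_query n D) = Violated j"
      by (cases "orc h1 (rank_query n D)") auto
    then have rank_v: "correct_answer \<Phi> (rank_query n D) (Violated j)" using rank_ok by simp
    note progress = inst shape sound test_v rank_v
    have jm: "j < m" using progress by (rule answer_index)
    have gj: "g j < n" using shape jm by (simp add: search_shape_def)
    define s2 where "s2 = s(11 := Suc j, 12 := 21 + 2 * n + j, 13 := g j)"
    define h2 where "h2 = (rank_query n D, Violated j) # h1"
    have rep2: "represents n m D t l g s2"
      unfolding s2_def by (intro represents_upd rep) auto
    have rep1: "represents n m D t l g (s(11 := Suc i))"
      by (intro represents_upd rep) auto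
    have s2: "s2 12 = 21 + 2 * n + j" "s2 13 = g j" "s2 9 = t" "s2 2 = 1" "s2 3 = 0" "s2 11 = Suc j"
      using rep s2 s3 by (auto simp: s2_def represents_def)
    have "reaches n orc 5 (W, s, h) (refine # Skip # W, s(11 := Suc i), h1)"
      using test Violated by (simp add: h1_def)
    moreover have "reaches n orc 8 (refine # Skip # W, s(11 := Suc i), h1)
        ((if g j < t then extend else IfLess 9 13 raise_last increment) # Skip # Skip # W, s2, h2)"
      using rank_run[of n m D t l g _ orc h1, OF rep1 j jm, of "Skip # W"] by (simp add: s2_def h2_def)
    ultimately have start: "reaches n orc 13 (W, s, h)
        ((if g j < t then extend else IfLess 9 13 raise_last increment) # Skip # Skip # W, s2, h2)"
      by (rule reaches_trans) simp
    consider "g j < t" | "t < g j" | "g j = t" by linarith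
    then show ?thesis
    proof cases
      case 1
      obtain s' where s': "reaches n orc 13 (extend # Skip # Skip # W, s2, h2) (Skip # Skip # W, s', h2)"
        "represents n m (insert (g j) D) (g j) j g s'"
        by (rule extend_run[OF rep2 s2(1,2) gj])
      have "reaches n orc 13 (W, s, h) (extend # Skip # Skip # W, s2, h2)"
        using start 1 by simp
      then have "reaches n orc 26 (W, s, h) (Skip # Skip # W, s', h2)"
        by (rule reaches_trans[OF _ s'(1)]) simp
      then have "reaches n orc 28 (W, s, h) (W, s', h2)"
        by (rule reaches_trans[OF _ two_skips]) simp
      moreover have "search_state n m \<Phi> (insert (g j) D) (g j) j g s'"
        using s'(2) search_extend[OF progress 1] by (simp add: search_state_def)
      moreover have "potential n m (g j) g < potential n m t g"
        "28 + 40 * potential n m (g j) g \<le> 40 * potential n m t g"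
        using 1 by (simp_all add: potential_def)
      ultimately show ?thesis by (intro disjI2 exI conjI)
    next
      case 2
      note raised = search_raise[OF progress 2]
      have tn: "t < n" using 2 gj by simp
      have "reaches n orc 13 (W, s, h) (IfLess 9 13 raise_last increment # Skip # Skip # W, s2, h2)"
        using start 2 by simp
      moreover have "reaches n orc 1 (IfLess 9 13 raise_last increment # Skip # Skip # W, s2, h2)
          (raise_last # Skip # Skip # W, s2, h2)"
        by (rule reachesI[where t = 1]) (use s2 2 in auto)
      ultimately have inc: "reaches n orc 14 (W, s, h) (raise_last # Skip # Skip # W, s2, h2)"
        by (rule reaches_trans) simp
      obtain s' where s':
        "reaches n orc (12 * n + 16) (raise_last # Skip # Skip # W, s2, h2) (Skip # Skip # W, s', h2)"
        "represents n m {} n 0 (g(l := g j)) s'"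
        by (rule raise_run[OF rep2 s2(2) tn raised(1)])
      have "reaches n orc (12 * n + 30) (W, s, h) (Skip # Skip # W, s', h2)"
        by (rule reaches_trans[OF inc s'(1)]) simp
      then have "reaches n orc (12 * n + 40) (W, s, h) (W, s', h2)"
        by (rule reaches_trans[OF _ two_skips]) simp
      moreover have "search_state n m \<Phi> {} n 0 (g(l := g j)) s'"
        using s'(2) raised by (simp add: search_state_def)
      moreover have "potential n m n (g(l := g j)) + n + 2 \<le> potential n m t g"
        by (rule potential_update) (use raised 2 tn in auto)
      then have "potential n m n (g(l := g j)) < potential n m t g"
        "12 * n + 40 + 40 * potential n m n (g(l := g j)) \<le> 40 * potential n m t g"
        by simp_all
      ultimately show ?thesis by (intro disjI2 exI conjI)
    next
      case 3
      note incr = search_increment[OF progress 3]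
      have s13: "s2 13 = t" using s2 3 by simp
      have "reaches n orc 13 (W, s, h) (IfLess 9 13 raise_last increment # Skip # Skip # W, s2, h2)"
        using start 3 by simp
      moreover have "reaches n orc 1 (IfLess 9 13 raise_last increment # Skip # Skip # W, s2, h2)
          (increment # Skip # Skip # W, s2, h2)"
        by (rule reachesI[where t = 1]) (use s2 3 in auto)
      ultimately have inc: "reaches n orc 14 (W, s, h) (increment # Skip # Skip # W, s2, h2)"
        by (rule reaches_trans) simp
      show ?thesis
      proof (cases "Suc t < n")
        case True
        obtain s' where s':
          "reaches n orc (12 * n + 20) (increment # Skip # Skip # W, s2, h2) (Skip # Skip # W, s', h2)"
          "represents n m {} n 0 (g(j := Suc t)) s'"
          using increment_run(1)[OF rep2 s2(1) s13 jm True] by atomize_elim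
        have "reaches n orc (12 * n + 34) (W, s, h) (Skip # Skip # W, s', h2)"
          by (rule reaches_trans[OF inc s'(1)]) simp
        then have "reaches n orc (12 * n + 40) (W, s, h) (W, s', h2)"
          by (rule reaches_trans[OF _ two_skips]) simp
        moreover have "search_state n m \<Phi> {} n 0 (g(j := Suc t)) s'"
          using s'(2) incr True by (simp add: search_state_def)
        moreover have "potential n m n (g(j := Suc t)) + n + 2 \<le> potential n m t g"
          by (rule potential_update) (use jm gj 3 in auto)
        then have "potential n m n (g(j := Suc t)) < potential n m t g"
          "12 * n + 40 + 40 * potential n m n (g(j := Suc t)) \<le> 40 * potential n m t g"
          by simp_all
        ultimately show ?thesis by (intro disjI2 exI conjI)
      next
        case False
        define s' where "s' = s2(13 := Suc t, 21 + 2 * n + j := Suc t, 17 := 1)"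
        have "reaches n orc 22 (W, s, h) (Skip # Skip # W, s', h2)"
          unfolding s'_def
          by (rule reaches_trans[OF inc increment_run(2)[OF rep2 s2(1) s13 jm False]]) simp
        then have "reaches n orc 24 (W, s, h) (W, s', h2)"
          by (rule reaches_trans[OF _ two_skips]) simp
        moreover have "reaches n orc 1 (W, s', h2) (K, s', h2)"
          by (rule reachesI[where t = 1]) (use s2 in \<open>auto simp: W_def s'_def\<close>)
        ultimately have "reaches n orc 40 (W, s, h) (K, s', h2)"
          by (rule reaches_trans) simp
        moreover have "\<not> satisfiable \<Phi>" using incr(1) False by blast
        \<comment> \<open>Cell 11 still holds the code \<open>Suc j\<close> of the rank answer;
          being nonzero, it is read as a negative verdict.\<close>
        then have "s' 3 = 0" "s' 11 = 0 \<longleftrightarrow> satisfiable \<Phi>" using s2 by (auto simp: s'_def)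
        ultimately show ?thesis by (intro disjI1 exI conjI)
      qed
    qed
  qed
qed

text \<open>The costs of the continuing iterations telescope along the potential; the additive 40
  pays for the last one.\<close>

lemma search_loop:
  assumes inst: "one_sat_instance n m \<Phi>" and orc: "worst_violated_answerer n \<Phi> orc"
    and "search_state n m \<Phi> D t l g s"
  shows "\<exists>s' h'. reaches n orc (40 * potential n m t g + 40)
      (WhileLess 17 2 search_body # K, s, h) (K, s', h') \<and>
    s' 3 = 0 \<and> (s' 11 = 0 \<longleftrightarrow> satisfiable \<Phi>)"
  using assms(3)
proof (induction "potential n m t g" arbitrary: D t l g s h rule: less_induct)
  case less
  let ?W = "WhileLess 17 2 search_body # K"
  from search_iteration[OF inst orc less.prems, of K h] show ?case
  proof (elim disjE exE conjE)
    fix s' h' assume *: "reaches n orc 40 (?W, s, h) (K, s', h')" "s' 3 = 0"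
      "(s' 11 = 0) = satisfiable \<Phi>"
    have "reaches n orc (40 * potential n m t g + 40) (?W, s, h) (K, s', h')"
      by (rule reaches_trans[OF *(1) reachesI[where t = 0]]) auto
    then show ?thesis using *(2,3) by (intro exI conjI)
  next
    fix D' t' l' g' s1 h1 b
    assume *: "reaches n orc b (?W, s, h) (?W, s1, h1)" "search_state n m \<Phi> D' t' l' g' s1"
      "potential n m t' g' < potential n m t g"
      "b + 40 * potential n m t' g' \<le> 40 * potential n m t g"
    obtain s' h' where **: "reaches n orc (40 * potential n m t' g' + 40) (?W, s1, h1) (K, s', h')"
      "s' 3 = 0" "(s' 11 = 0) = satisfiable \<Phi>"
      using less.hyps[OF *(3,2), of h1] by atomize_elim
    have "reaches n orc (40 * potential n m t g + 40) (?W, s, h) (K, s', h')"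
      by (rule reaches_trans[OF *(1) **(1)]) (use * in simp)
    then show ?thesis using **(2,3) by (intro exI conjI)
  qed
qed

lemma solver_run:
  assumes inst: "one_sat_instance n m \<Phi>" and orc: "worst_violated_answerer n \<Phi> orc"
  shows "\<exists>s h. reaches n orc (40 * (m * n * (2 * n + 2) + n) + 12 * n + 74)
      (init_config solver n m) ([], s, h) \<and> s 0 = (if satisfiable \<Phi> then 1 else 0)"
proof -
  define F where "F = block [IfLess 3 11 (SetConst 0 0) (SetConst 0 1)]"
  define L where "L = block [WhileLess 17 2 search_body, IfLess 3 11 (SetConst 0 0) (SetConst 0 1)]"
  define s1 :: memory where "s1 = (\<lambda>_. 0)(0 := n, 1 := m, 2 := 1, 5 := n + 1, 4 := 2 * n + 2, 6 := 20,
    7 := 20 + n, 8 := 20 + 2 * n)"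
  have "reaches n orc 13 (init_config solver n m) (reset # L # [], s1, [])"
    by (rule reachesI[where t = 13])
      (auto simp: run_simps solver_def init_config_def L_def s1_def intro!: ext)
  moreover have "registers n m (\<lambda>_. 0) s1" by (auto simp: registers_def s1_def)
  then obtain s2 where s2: "reaches n orc (12 * n + 12) (reset # L # [], s1, []) (L # [], s2, [])"
    "represents n m {} n 0 (\<lambda>_. 0) s2" by (rule reset_run)
  ultimately have "reaches n orc (12 * n + 25) (init_config solver n m) (L # [], s2, [])"
    using reaches_trans by fastforce
  moreover have "reaches n orc 1 (L # [], s2, []) (WhileLess 17 2 search_body # F # [], s2, [])"
    by (rule reachesI[where t = 1]) (auto simp: L_def F_def block_def)
  ultimately have a: "reaches n orc (12 * n + 26) (init_config solver n m)
      (WhileLess 17 2 search_body # F # [], s2, [])"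
    using reaches_trans by fastforce
  \<comment> \<open>The zero table must have entries below \<open>n\<close>, so the presence of a
    clause has to force a variable.\<close>
  have "0 < n" if "0 < m"
    using inst that by (cases \<Phi>) (auto simp: one_sat_instance_def)
  then have "search_state n m \<Phi> {} n 0 (\<lambda>_. 0) s2"
    using s2(2) by (auto simp: search_state_def search_shape_def search_sound_def)
  \<comment> \<open>With all bounds 0 and threshold \<open>n\<close>, the potential is
    \<open>m * n * (2 * n + 2) + n\<close>.\<close>
  from search_loop[OF inst orc this, of "F # []" "[]"]
  obtain s3 h3 where s3: "reaches n orc (40 * (m * n * (2 * n + 2) + n) + 40)
      (WhileLess 17 2 search_body # F # [], s2, []) (F # [], s3, h3)"
    "s3 3 = 0" "s3 11 = 0 \<longleftrightarrow> satisfiable \<Phi>"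
    by (auto simp: potential_def)
  have b: "reaches n orc (40 * (m * n * (2 * n + 2) + n) + 12 * n + 66) (init_config solver n m)
      (F # [], s3, h3)"
    by (rule reaches_trans[OF a s3(1)]) simp
  have c: "reaches n orc 4 (F # [], s3, h3) ([], s3(0 := if satisfiable \<Phi> then 1 else 0), h3)"
    by (rule reachesI[where t = 4]) (use s3(2,3) in \<open>auto simp: F_def run_simps\<close>)
  have "reaches n orc (40 * (m * n * (2 * n + 2) + n) + 12 * n + 74) (init_config solver n m)
      ([], s3(0 := if satisfiable \<Phi> then 1 else 0), h3)"
    by (rule reaches_trans[OF b c]) simp
  moreover have "(s3(0 := if satisfiable \<Phi> then 1 else 0)) 0 = (if satisfiable \<Phi> then 1 else 0 :: nat)"
    by simp
  ultimately show ?thesis by (intro exI conjI)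
qed

theorem theorem2:
  "\<exists>(P :: com) (C :: nat). \<forall>(n :: nat) (m :: nat) (\<Phi> :: literal list) (orc :: answerer).
     one_sat_instance n m \<Phi> \<longrightarrow> worst_violated_answerer n \<Phi> orc \<longrightarrow>
     (\<exists>t. halts_with P n m orc t (satisfiable \<Phi>) \<and> (1 \<le> m \<longrightarrow> t \<le> C * (m * n\<^sup>2)))"
proof (rule exI[of _ solver], rule exI[of _ 300], intro allI impI)
  fix n m \<Phi> orc
  assume inst: "one_sat_instance n m \<Phi>" and orc: "worst_violated_answerer n \<Phi> orc"
  obtain t where t: "halts_with solver n m orc t (satisfiable \<Phi>)"
    "t \<le> 40 * (m * n * (2 * n + 2) + n) + 12 * n + 74"
    using solver_run[OF inst orc] by (auto simp: reaches_def halts_with_def)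
  have "t \<le> 300 * (m * n\<^sup>2)" if "1 \<le> m"
  proof -
    \<comment> \<open>A clause needs a variable, so \<open>m * n\<close>, \<open>n\<close> and 1 are
      all at most \<open>m * n\<^sup>2\<close>. The coefficients then add up to 80 + 80 + 52 + 74 =
      286, below 300.\<close>
    have "1 \<le> n" using inst that by (cases \<Phi>) (auto simp: one_sat_instance_def)
    then have "n \<le> n\<^sup>2" "1 \<le> n\<^sup>2" by (simp_all add: power2_eq_square)
    then have le: "m * n \<le> m * n\<^sup>2" "n \<le> m * n\<^sup>2" "1 \<le> m * n\<^sup>2"
      using that by (simp_all add: le_trans[OF _ mult_le_mono1[of 1 m]])
    have "m * n * (2 * n + 2) = 2 * (m * n\<^sup>2) + 2 * (m * n)"
      by (simp add: power2_eq_square algebra_simps)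
    with t(2) have "t \<le> 80 * (m * n\<^sup>2) + 80 * (m * n) + 52 * n + 74"
      by (simp add: power2_eq_square)
    then show ?thesis using le by linarith
  qed
  with t(1) show "\<exists>t. halts_with solver n m orc t (satisfiable \<Phi>) \<and>
      (1 \<le> m \<longrightarrow> t \<le> 300 * (m * n\<^sup>2))" by blast
qed

end
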